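(* Work with hereditarily finite sets built over a single atom $\heartsuit$. For a set $M$ put $M_L=\{A: A\in M,\ \heartsuit\notin A\}$ and $M_R=\{A: A\cup\{\heartsuit\}\in M,\ \heartsuit\notin A\}$. Let $\overrightarrow{\mathcal R}_\in$ be the directed graph whose vertices are all (hereditarily) finite sets $M$ (in this model) with $\heartsuit\notin M$, and in which $(M,N)$ is an edge if and only if $M\in N_L$ or $N\in M_R$. Then $\overrightarrow{\mathcal R}_\in$ is isomorphic to the generic directed graph, i.e. it is ultrahomogeneous and every countable directed graph is isomorphic to an induced subgraph of it.
   Context: Here a directed graph is a set with a binary edge relation, without loops. A structure is ultrahomogeneous if every isomorphism between two finite induced substructures extends to an automorphism of the whole structure. The generic directed graph is the (unique up to isomorphism) countable ultrahomogeneous directed graph into which every countable directed graph embeds as an induced subgraph. *)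

theory Defs
  imports "Graph_Theory.Graph_Theory" "HOL-Library.FSet" "HOL-Library.Countable_Set"
begin

section \<open>Directed graphs as relational structures\<close>

text \<open>
  A directed graph is a vertex set with a loop-free binary edge relation, i.e. a
  \<^locale>\<open>pair_loopfree_digraph\<close>. The vertex set may be infinite or empty, and both \<open>(u, v)\<close>
  and \<open>(v, u)\<close> may be edges. Isomorphisms are given by their vertex maps, since
  ultrahomogeneity speaks about extending such maps.
\<close>

definition digraph_isomorphism_map ::
    "('a \<Rightarrow> 'b) \<Rightarrow> 'a pair_pre_digraph \<Rightarrow> 'b pair_pre_digraph \<Rightarrow> bool" where
  "digraph_isomorphism_map f G H \<longleftrightarrow>
     bij_betw f (pverts G) (pverts H) \<and>
     (\<forall>u\<in>pverts G. \<forall>v\<in>pverts G. (u, v) \<in> parcs G \<longleftrightarrow> (f u, f v) \<in> parcs H)"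

definition isomorphic_digraphs :: "'a pair_pre_digraph \<Rightarrow> 'b pair_pre_digraph \<Rightarrow> bool" where
  "isomorphic_digraphs G H \<longleftrightarrow> (\<exists>f. digraph_isomorphism_map f G H)"

abbreviation induced_pair_subgraph :: "'a pair_pre_digraph \<Rightarrow> 'a pair_pre_digraph \<Rightarrow> bool" where
  "induced_pair_subgraph A G \<equiv> induced_subgraph (with_proj A) (with_proj G)"

definition embeds_induced :: "'a pair_pre_digraph \<Rightarrow> 'b pair_pre_digraph \<Rightarrow> bool" where
  "embeds_induced H G \<longleftrightarrow> (\<exists>K. induced_pair_subgraph K G \<and> isomorphic_digraphs H K)"

definition ultrahomogeneous :: "'a pair_pre_digraph \<Rightarrow> bool" where
  "ultrahomogeneous G \<longleftrightarrow>
     (\<forall>A B f. induced_pair_subgraph A G \<and> finite (pverts A) \<and>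
        induced_pair_subgraph B G \<and> finite (pverts B) \<and>
        digraph_isomorphism_map f A B \<longrightarrow>
        (\<exists>g. digraph_isomorphism_map g G G \<and> (\<forall>a\<in>pverts A. g a = f a)))"

definition countable_digraph :: "'a pair_pre_digraph \<Rightarrow> bool" where
  "countable_digraph G \<longleftrightarrow> pair_loopfree_digraph G \<and> countable (pverts G)"

text \<open>
  A definition cannot quantify over all vertex types, so universality is stated for the
  directed graphs whose vertices are natural numbers; every countable directed graph is
  isomorphic to one of these.
\<close>

definition generic_digraph :: "'a pair_pre_digraph \<Rightarrow> bool" where
  "generic_digraph G \<longleftrightarrow>
     countable_digraph G \<and> ultrahomogeneous G \<and>
     (\<forall>H :: nat pair_pre_digraph. countable_digraph H \<longrightarrow> embeds_induced H G)"

section \<open>Hereditarily finite sets over a single atom\<close>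

text \<open>
  An object is either the atom \<open>Heart\<close> or a finite set of objects. Injectivity of \<open>HSet\<close>
  is extensionality, and the datatype being freely generated gives foundation. The atom is not
  a set; in particular it differs from the empty set \<open>HSet {||}\<close>.
\<close>

datatype hf = Heart | HSet "hf fset"

fun elts :: "hf \<Rightarrow> hf set" where
  "elts Heart = {}"
| "elts (HSet S) = fset S"

text \<open>In both sets below, the member \<open>A = HSet S\<close> ranges over sets, not over the atom.\<close>

definition left_part :: "hf \<Rightarrow> hf set" where
  "left_part M = {HSet S | S. HSet S \<in> elts M \<and> Heart |\<notin>| S}"

definition right_part :: "hf \<Rightarrow> hf set" where
  "right_part M = {HSet S | S. HSet (S |\<union>| {|Heart|}) \<in> elts M \<and> Heart |\<notin>| S}"

definition R_in :: "hf pair_pre_digraph" where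
  "R_in =
     (let V = {HSet S | S. Heart |\<notin>| S}
      in \<lparr>pverts = V,
          parcs = {(M, N). M \<in> V \<and> N \<in> V \<and> (M \<in> left_part N \<or> N \<in> right_part M)}\<rparr>)"

end

theory Submission
  imports Defs
begin

text \<open>
  Everything rests on the extension property: over any finite set of vertices, every prescribed
  pattern of in- and out-edges is realised by a new vertex. Any two countable directed graphs with
  this property are isomorphic by back-and-forth, and the isomorphism can extend any given finite
  partial isomorphism, which yields both ultrahomogeneity and uniqueness; going only forth yields
  universality. Conversely a generic directed graph has the property: embed an abstract one-point
  extension of the finite subgraph and move its base back into place by an automorphism.

  In \<open>R_in\<close>, to realise in-edges from \<open>I\<close> and out-edges to \<open>J\<close> over a finite \<open>A\<close>, take the set
  with members the elements of \<open>I\<close>, the sets \<open>N \<union> {\<heartsuit>}\<close> for \<open>N \<in> J\<close>, and \<open>A\<close> itself. The last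
  member places the new vertex above all of \<open>A\<close> in the membership order, so it is new and no
  element of \<open>A\<close> can refer to it.
\<close>

section \<open>The extension property\<close>

text \<open>Directed analogue of the axiom characterising the Rado graph. \<open>I\<close> and
  \<open>J\<close> matter only through their traces on \<open>A\<close> and are independent, so a
  pair of opposite arcs may be prescribed.\<close>

definition extension_property :: "'a pair_pre_digraph \<Rightarrow> bool" where
  "extension_property G \<longleftrightarrow>
     (\<forall>A I J. finite A \<and> A \<subseteq> pverts G \<longrightarrow>
        (\<exists>z\<in>pverts G - A. \<forall>a\<in>A.
           ((a, z) \<in> parcs G \<longleftrightarrow> a \<in> I) \<and> ((z, a) \<in> parcs G \<longleftrightarrow> a \<in> J)))"

lemma extension_propertyE:
  assumes "extension_property G" "finite A" "A \<subseteq> pverts G"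
  obtains z where "z \<in> pverts G" "z \<notin> A"
    "\<And>a. a \<in> A \<Longrightarrow> (a, z) \<in> parcs G \<longleftrightarrow> a \<in> I"
    "\<And>a. a \<in> A \<Longrightarrow> (z, a) \<in> parcs G \<longleftrightarrow> a \<in> J"
proof -
  have "\<exists>z\<in>pverts G - A. \<forall>a\<in>A.
      ((a, z) \<in> parcs G \<longleftrightarrow> a \<in> I) \<and> ((z, a) \<in> parcs G \<longleftrightarrow> a \<in> J)"
    using assms by (simp add: extension_property_def)
  then show thesis using that by blast
qed

section \<open>Partial isomorphisms and back-and-forth\<close>

text \<open>A relation rather than a map, so that converses and unions of chains stay within the
  notion. The equivalence of equalities is single-valuedness and injectivity at once.\<close>

definition partial_iso :: "'a pair_pre_digraph \<Rightarrow> 'b pair_pre_digraph \<Rightarrow> ('a \<times> 'b) set \<Rightarrow> bool" where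
  "partial_iso G H p \<longleftrightarrow> p \<subseteq> pverts G \<times> pverts H \<and>
     (\<forall>(x, y)\<in>p. \<forall>(x', y')\<in>p.
        (x = x' \<longleftrightarrow> y = y') \<and> ((x, x') \<in> parcs G \<longleftrightarrow> (y, y') \<in> parcs H))"

lemma partial_isoI:
  assumes "p \<subseteq> pverts G \<times> pverts H"
    and "\<And>x y x' y'. (x, y) \<in> p \<Longrightarrow> (x', y') \<in> p \<Longrightarrow>
      (x = x' \<longleftrightarrow> y = y') \<and> ((x, x') \<in> parcs G \<longleftrightarrow> (y, y') \<in> parcs H)"
  shows "partial_iso G H p"
  using assms by (simp add: partial_iso_def split_beta)

lemma partial_isoD:
  assumes "partial_iso G H p" "(x, y) \<in> p" "(x', y') \<in> p"
  shows "x = x' \<longleftrightarrow> y = y'" "(x, x') \<in> parcs G \<longleftrightarrow> (y, y') \<in> parcs H"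
  using assms unfolding partial_iso_def by fast+

lemma partial_iso_converse: "partial_iso G H p \<Longrightarrow> partial_iso H G (p\<inverse>)"
  unfolding partial_iso_def by fast

lemma no_loop: "pair_loopfree_digraph G \<Longrightarrow> (x, x) \<notin> parcs G"
  using pair_loopfree_digraph.pair_no_loops by fastforce

text \<open>The arcs between \<open>x\<close> and the domain of \<open>p\<close> are transported
  along \<open>p\<close> to a pattern over its range, which the extension property of
  \<open>H\<close> realises.\<close>

lemma partial_iso_forth:
  assumes G: "pair_loopfree_digraph G" and H: "pair_loopfree_digraph H" "extension_property H"
    and p: "partial_iso G H p" "finite p" and x: "x \<in> pverts G"
  shows "\<exists>q. p \<subseteq> q \<and> partial_iso G H q \<and> finite q \<and> x \<in> Domain q"
proof (cases "x \<in> Domain p")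
  case True
  with p show ?thesis by blast
next
  case False
  have "finite (Range p)" "Range p \<subseteq> pverts H"
    using p by (auto simp: partial_iso_def finite_Range)
  then obtain z where z: "z \<in> pverts H" "z \<notin> Range p"
    and e: "\<And>b. b \<in> Range p \<Longrightarrow>
        (b, z) \<in> parcs H \<longleftrightarrow> b \<in> {y. \<exists>a. (a, y) \<in> p \<and> (a, x) \<in> parcs G}"
      "\<And>b. b \<in> Range p \<Longrightarrow>
        (z, b) \<in> parcs H \<longleftrightarrow> b \<in> {y. \<exists>a. (a, y) \<in> p \<and> (x, a) \<in> parcs G}"
    using extension_propertyE[OF H(2)] by blast
  have e': "((b, z) \<in> parcs H \<longleftrightarrow> (a, x) \<in> parcs G) \<and> ((z, b) \<in> parcs H \<longleftrightarrow> (x, a) \<in> parcs G)"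
    "x \<noteq> a" "z \<noteq> b" if "(a, b) \<in> p" for a b
  proof -
    \<comment> \<open>Injectivity of \<open>p\<close> leaves \<open>a\<close> as the only possible
      witness of the existentials in \<open>e\<close>.\<close>
    have "a' = a" if "(a', b) \<in> p" for a'
      using partial_isoD(1)[OF p(1) that \<open>(a, b) \<in> p\<close>] by simp
    with e(1)[of b] e(2)[of b] that
    show "((b, z) \<in> parcs H \<longleftrightarrow> (a, x) \<in> parcs G) \<and> ((z, b) \<in> parcs H \<longleftrightarrow> (x, a) \<in> parcs G)"
      by blast
    show "x \<noteq> a" "z \<noteq> b" using that False z by auto
  qed
  have "partial_iso G H (insert (x, z) p)"
  proof (rule partial_isoI)
    show "insert (x, z) p \<subseteq> pverts G \<times> pverts H"
      using p z x by (auto simp: partial_iso_def)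
  next
    fix a b a' b' assume "(a, b) \<in> insert (x, z) p" "(a', b') \<in> insert (x, z) p"
    \<comment> \<open>The pair \<open>(x, z)\<close> against itself is the case outside
      \<open>e'\<close> and \<open>p\<close>; there both arcs are absent, being loops.\<close>
    then show "(a = a' \<longleftrightarrow> b = b') \<and> ((a, a') \<in> parcs G \<longleftrightarrow> (b, b') \<in> parcs H)"
      using e'[of a b] e'[of a' b'] partial_isoD[OF p(1), of a b a' b']
        no_loop[OF G] no_loop[OF H(1)] by auto
  qed
  then show ?thesis using p(2) by (intro exI[of _ "insert (x, z) p"]) auto
qed

text \<open>The condition inspects two pairs at a time, and any two pairs lie in a common
  stage.\<close>

lemma partial_iso_Union_chain:
  fixes P :: "nat \<Rightarrow> ('a \<times> 'b) set"
  assumes P: "\<And>n. partial_iso G H (P n)" and mono: "mono P"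
  shows "partial_iso G H (\<Union>n. P n)"
proof (rule partial_isoI)
  show "(\<Union>n. P n) \<subseteq> pverts G \<times> pverts H"
    using P unfolding partial_iso_def by fast
next
  fix x y x' y' assume "(x, y) \<in> (\<Union>n. P n)" "(x', y') \<in> (\<Union>n. P n)"
  then obtain m n where "(x, y) \<in> P m" "(x', y') \<in> P n" by blast
  then have "(x, y) \<in> P (max m n)" "(x', y') \<in> P (max m n)"
    using monoD[OF mono, of m "max m n"] monoD[OF mono, of n "max m n"] by auto
  then show "(x = x' \<longleftrightarrow> y = y') \<and> ((x, x') \<in> parcs G \<longleftrightarrow> (y, y') \<in> parcs H)"
    using partial_isoD[OF P[of "max m n"]] by simp
qed

text \<open>
  With \<open>B = {}\<close> this is the forth-only version, with \<open>B = pverts H\<close> the full back-and-forth.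
\<close>

lemma back_and_forth:
  assumes G: "pair_loopfree_digraph G" "countable (pverts G)"
    and H: "pair_loopfree_digraph H" "extension_property H"
    and B: "countable B" "B \<subseteq> pverts H" "B \<noteq> {} \<Longrightarrow> extension_property G"
    and p: "partial_iso G H p" "finite p"
  shows "\<exists>r. p \<subseteq> r \<and> partial_iso G H r \<and> Domain r = pverts G \<and> B \<subseteq> Range r"
proof -
  define meets where "meets n q \<longleftrightarrow>
      (\<forall>x\<in>pverts G. to_nat_on (pverts G) x = n \<longrightarrow> x \<in> Domain q) \<and>
      (\<forall>y\<in>B. to_nat_on B y = n \<longrightarrow> y \<in> Range q)" for n q
  let ?P = "\<lambda>q. partial_iso G H q \<and> finite q \<and> p \<subseteq> q"
  have step: "\<exists>r. ?P r \<and> q \<subseteq> r \<and> meets n r" if q: "?P q" for q n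
  proof -
    have "\<exists>q'. q \<subseteq> q' \<and> partial_iso G H q' \<and> finite q' \<and>
        (\<forall>x\<in>pverts G. to_nat_on (pverts G) x = n \<longrightarrow> x \<in> Domain q')"
    proof (cases "\<exists>x\<in>pverts G. to_nat_on (pverts G) x = n")
      case True
      then obtain x where x: "x \<in> pverts G" "to_nat_on (pverts G) x = n" by blast
      then have "x' = x" if "x' \<in> pverts G" "to_nat_on (pverts G) x' = n" for x'
        using that G(2) by (metis to_nat_on_inj)
      then show ?thesis
        using partial_iso_forth[OF G(1) H, of q x] x q by metis
    qed (use q in blast)
    then obtain q' where q': "q \<subseteq> q'" "partial_iso G H q'" "finite q'"
      and D: "\<forall>x\<in>pverts G. to_nat_on (pverts G) x = n \<longrightarrow> x \<in> Domain q'" by blast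
    have "\<exists>r. q' \<subseteq> r \<and> partial_iso G H r \<and> finite r \<and>
        (\<forall>y\<in>B. to_nat_on B y = n \<longrightarrow> y \<in> Range r)"
    proof (cases "\<exists>y\<in>B. to_nat_on B y = n")
      case True
      then obtain y where y: "y \<in> B" "to_nat_on B y = n" by blast
      then have uniq: "y' = y" if "y' \<in> B" "to_nat_on B y' = n" for y'
        using that B(1) by (metis to_nat_on_inj)
      \<comment> \<open>The back step is the forth step for the converse; \<open>y\<close> witnesses
        that \<open>B\<close> is nonempty, which releases the extension property of
        \<open>G\<close>.\<close>
      obtain s where s: "q'\<inverse> \<subseteq> s" "partial_iso H G s" "finite s" "y \<in> Domain s"
        using partial_iso_forth[OF H(1) G(1), of "q'\<inverse>" y] partial_iso_converse[OF q'(2)]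
          q'(3) y B by auto
      have "q' \<subseteq> s\<inverse>" "y \<in> Range (s\<inverse>)" "finite (s\<inverse>)" using s by auto
      then show ?thesis
        using partial_iso_converse[OF s(2)] uniq by metis
    qed (use q' in blast)
    then obtain r where "q' \<subseteq> r" "partial_iso G H r" "finite r"
      "\<forall>y\<in>B. to_nat_on B y = n \<longrightarrow> y \<in> Range r" by blast
    then show ?thesis using q q' D unfolding meets_def by (intro exI[of _ r]) blast
  qed
  have "\<exists>P. \<forall>n. ?P (P n) \<and> (P n \<subseteq> P (Suc n) \<and> meets n (P (Suc n)))"
  proof (rule dependent_nat_choice)
    show "\<exists>q. ?P q" using p by blast
    show "\<exists>r. ?P r \<and> q \<subseteq> r \<and> meets n r" if "?P q" for q n
      using step[OF that] .
  qed
  then obtain P where P: "\<And>n. ?P (P n)" "\<And>n. P n \<subseteq> P (Suc n) \<and> meets n (P (Suc n))"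
    by blast
  define r where "r = (\<Union>n. P n)"
  have "mono P" using P(2) by (simp add: mono_iff_le_Suc)
  with P(1) have r: "partial_iso G H r"
    unfolding r_def by (intro partial_iso_Union_chain) auto
  \<comment> \<open>A vertex of index \<open>n\<close> has entered by
    \<open>P (Suc n)\<close>.\<close>
  have "x \<in> Domain r" if "x \<in> pverts G" for x
    using that P(2)[of "to_nat_on (pverts G) x"] unfolding meets_def r_def by blast
  moreover have "y \<in> Range r" if "y \<in> B" for y
    using that P(2)[of "to_nat_on B y"] unfolding meets_def r_def by blast
  moreover have "p \<subseteq> r" using P(1)[of 0] unfolding r_def by blast
  moreover have "Domain r \<subseteq> pverts G" using r by (auto simp: partial_iso_def)
  ultimately show ?thesis using r by blast
qed

text \<open>Turns the relation built in stages into the vertex map required by isomorphisms and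
  embeddings.\<close>

lemma partial_iso_imp_function:
  assumes r: "partial_iso G H r" "Domain r = pverts G"
  obtains f where "r = {(x, f x) |x. x \<in> pverts G}" "inj_on f (pverts G)"
    "\<And>u v. u \<in> pverts G \<Longrightarrow> v \<in> pverts G \<Longrightarrow> (u, v) \<in> parcs G \<longleftrightarrow> (f u, f v) \<in> parcs H"
proof -
  have "\<forall>x\<in>pverts G. \<exists>y. (x, y) \<in> r" using r(2) by blast
  then obtain f where f: "\<And>x. x \<in> pverts G \<Longrightarrow> (x, f x) \<in> r" by metis
  show thesis
  proof
    show "r = {(x, f x) |x. x \<in> pverts G}"
    proof (rule set_eqI)
      fix u :: "'a \<times> 'b"
      obtain x y where [simp]: "u = (x, y)" by fastforce
      show "u \<in> r \<longleftrightarrow> u \<in> {(x, f x) |x. x \<in> pverts G}"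
        using f[of x] r(2) partial_isoD(1)[OF r(1), of x y x "f x"] by auto
    qed
    show "inj_on f (pverts G)"
      using partial_isoD(1)[OF r(1) f f] by (auto simp: inj_on_def)
    show "(u, v) \<in> parcs G \<longleftrightarrow> (f u, f v) \<in> parcs H" if "u \<in> pverts G" "v \<in> pverts G" for u v
      using partial_isoD(2)[OF r(1) f f] that by blast
  qed
qed

text \<open>Serves twice: with \<open>G = H\<close> for ultrahomogeneity, and with \<open>p\<close>
  empty for uniqueness.\<close>

lemma extension_property_extend_iso:
  assumes G: "countable_digraph G" "extension_property G"
    and H: "countable_digraph H" "extension_property H"
    and p: "partial_iso G H p" "finite p"
  obtains g where "digraph_isomorphism_map g G H" "\<And>x y. (x, y) \<in> p \<Longrightarrow> g x = y"
proof -
  obtain r where r: "p \<subseteq> r" "partial_iso G H r" "Domain r = pverts G" "pverts H \<subseteq> Range r"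
    using back_and_forth[of G H "pverts H" p] G H p by (auto simp: countable_digraph_def)
  obtain g where g: "r = {(x, g x) |x. x \<in> pverts G}" "inj_on g (pverts G)"
    "\<And>u v. u \<in> pverts G \<Longrightarrow> v \<in> pverts G \<Longrightarrow> (u, v) \<in> parcs G \<longleftrightarrow> (g u, g v) \<in> parcs H"
    using partial_iso_imp_function[OF r(2,3)] by blast
  have "g ` pverts G = pverts H"
    using r(2,4) g(1) by (auto simp: partial_iso_def)
  then show thesis
    using g r(1) by (intro that[of g]) (auto simp: digraph_isomorphism_map_def bij_betw_def)
qed

lemma extension_property_isomorphic:
  assumes "countable_digraph G" "extension_property G" "countable_digraph H" "extension_property H"
  shows "isomorphic_digraphs G H"
  using extension_property_extend_iso[OF assms, of "{}"]
  by (auto simp: partial_iso_def isomorphic_digraphs_def)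

section \<open>Ultrahomogeneity and universality\<close>

text \<open>Well-formedness of \<open>A\<close> is implicit on the right: by the last conjunct its
  arcs have both ends in \<open>pverts A\<close>.\<close>

lemma induced_pair_subgraph_iff:
  "induced_pair_subgraph A G \<longleftrightarrow>
     pair_wf_digraph G \<and> pverts A \<subseteq> pverts G \<and> parcs A = parcs G \<inter> pverts A \<times> pverts A"
proof -
  have wf: "wf_digraph (with_proj K) \<longleftrightarrow> pair_wf_digraph K" for K :: "'a pair_pre_digraph"
    by (auto simp: wf_digraph_def pair_wf_digraph_def)
  show ?thesis
    by (auto simp: induced_subgraph_def subgraph_def wf) (auto simp: pair_wf_digraph_def)
qed

lemma extension_property_ultrahomogeneous:
  assumes G: "countable_digraph G" "extension_property G"
  shows "ultrahomogeneous G"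
  unfolding ultrahomogeneous_def
proof (intro allI impI, elim conjE)
  fix A B f
  assume A: "induced_pair_subgraph A G" "finite (pverts A)" and B: "induced_pair_subgraph B G"
    and f: "digraph_isomorphism_map f A B"
  have V: "pverts A \<subseteq> pverts G" "pverts B \<subseteq> pverts G"
    and E: "parcs A = parcs G \<inter> pverts A \<times> pverts A" "parcs B = parcs G \<inter> pverts B \<times> pverts B"
    using A B by (auto simp: induced_pair_subgraph_iff)
  have fB: "f x \<in> pverts B" if "x \<in> pverts A" for x
    using f that by (auto simp: digraph_isomorphism_map_def bij_betw_def)
  have arc: "(x, y) \<in> parcs G \<longleftrightarrow> (f x, f y) \<in> parcs G" if "x \<in> pverts A" "y \<in> pverts A" for x y
    using f that E fB[OF that(1)] fB[OF that(2)] by (auto simp: digraph_isomorphism_map_def)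
  let ?p = "(\<lambda>x. (x, f x)) ` pverts A"
  have "inj_on f (pverts A)" using f by (auto simp: digraph_isomorphism_map_def bij_betw_def)
  then have "partial_iso G G ?p"
    using V fB arc by (auto simp: partial_iso_def inj_on_eq_iff)
  then obtain g where "digraph_isomorphism_map g G G" "\<And>x y. (x, y) \<in> ?p \<Longrightarrow> g x = y"
    using extension_property_extend_iso[OF G G] A(2) by blast
  then show "\<exists>g. digraph_isomorphism_map g G G \<and> (\<forall>a\<in>pverts A. g a = f a)"
    by blast
qed

text \<open>The induced copy \<open>K\<close> can be recovered from the embedding as the subgraph
  induced on its image.\<close>

lemma embeds_induced_iff:
  assumes "pair_wf_digraph G"
  shows "embeds_induced H G \<longleftrightarrow>
    (\<exists>f. inj_on f (pverts H) \<and> f ` pverts H \<subseteq> pverts G \<and>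
       (\<forall>u\<in>pverts H. \<forall>v\<in>pverts H. (u, v) \<in> parcs H \<longleftrightarrow> (f u, f v) \<in> parcs G))"
    (is "_ \<longleftrightarrow> (\<exists>f. ?emb f)")
proof
  assume "embeds_induced H G"
  then obtain K f where K: "induced_pair_subgraph K G" and f: "digraph_isomorphism_map f H K"
    by (auto simp: embeds_induced_def isomorphic_digraphs_def)
  have "?emb f"
    using f K by (auto simp: digraph_isomorphism_map_def bij_betw_def induced_pair_subgraph_iff)
  then show "\<exists>f. ?emb f" by blast
next
  assume "\<exists>f. ?emb f"
  then obtain f where f: "?emb f" ..
  let ?V = "f ` pverts H"
  let ?K = "\<lparr>pverts = ?V, parcs = parcs G \<inter> ?V \<times> ?V\<rparr>"
  have "induced_pair_subgraph ?K G"
    using f assms by (auto simp: induced_pair_subgraph_iff)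
  moreover have "digraph_isomorphism_map f H ?K"
    using f by (auto simp: digraph_isomorphism_map_def bij_betw_def)
  ultimately show "embeds_induced H G"
    by (auto simp: embeds_induced_def isomorphic_digraphs_def)
qed

lemma extension_property_universal:
  assumes G: "countable_digraph G" "extension_property G" and H: "countable_digraph H"
  shows "embeds_induced H G"
proof -
  \<comment> \<open>The arbitrary digraph \<open>H\<close> is the source and \<open>G\<close>
    supplies the patterns; \<open>B = {}\<close> makes the condition on the source vacuous.\<close>
  obtain r where r: "partial_iso H G r" "Domain r = pverts H"
    using back_and_forth[of H G "{}" "{}"] G H
    by (auto simp: countable_digraph_def partial_iso_def)
  obtain f where f: "r = {(x, f x) |x. x \<in> pverts H}" "inj_on f (pverts H)"
    "\<And>u v. u \<in> pverts H \<Longrightarrow> v \<in> pverts H \<Longrightarrow> (u, v) \<in> parcs H \<longleftrightarrow> (f u, f v) \<in> parcs G"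
    using partial_iso_imp_function[OF r] by blast
  have "f ` pverts H \<subseteq> pverts G" using r(1) f(1) by (auto simp: partial_iso_def)
  moreover have "pair_wf_digraph G"
    using G(1) by (simp add: countable_digraph_def pair_loopfree_digraph_def)
  ultimately show ?thesis using f by (auto simp: embeds_induced_iff)
qed

section \<open>From genericity back to the extension property\<close>

lemma generic_imp_extension_property:
  assumes "generic_digraph G"
  shows "extension_property G"
  unfolding extension_property_def
proof (intro allI impI, elim conjE)
  fix A I J assume A: "finite A" "A \<subseteq> pverts G"
  have G: "pair_loopfree_digraph G" "ultrahomogeneous G"
    and univ: "\<And>H :: nat pair_pre_digraph. countable_digraph H \<Longrightarrow> embeds_induced H G"
    using assms by (auto simp: generic_digraph_def countable_digraph_def)
  have wf: "pair_wf_digraph G" using G(1) by (simp add: pair_loopfree_digraph_def)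
  \<comment> \<open>Universality concerns digraphs on \<open>nat\<close>, so \<open>A\<close> is
    coded by the numbers below \<open>n\<close> and the vertex to be added by \<open>n\<close>
    itself.\<close>
  obtain h where h: "bij_betw h A {0..<card A}"
    using ex_bij_betw_finite_nat[OF A(1)] by blast
  define n where "n = card A"
  have hn: "h a < n" if "a \<in> A" for a using h that by (auto simp: n_def bij_betw_def)
  have h_eq: "h a = h b \<longleftrightarrow> a = b" if "a \<in> A" "b \<in> A" for a b
    using h that by (auto simp: bij_betw_def inj_on_eq_iff)
  define H :: "nat pair_pre_digraph" where
    "H = \<lparr>pverts = {..n},
          parcs = {(h a, h b) |a b. a \<in> A \<and> b \<in> A \<and> (a, b) \<in> parcs G} \<union>
            {(h a, n) |a. a \<in> A \<and> a \<in> I} \<union> {(n, h a) |a. a \<in> A \<and> a \<in> J}\<rparr>"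
  have "countable_digraph H"
    unfolding countable_digraph_def
  proof
    show "pair_loopfree_digraph H"
    proof
      fix e assume e: "e \<in> parcs H"
      then show "fst e \<in> pverts H" "snd e \<in> pverts H"
        by (auto simp: H_def dest: hn)
      show "fst e \<noteq> snd e"
        using e no_loop[OF G(1)] by (auto simp: H_def h_eq dest: hn)
    qed
  qed (simp add: H_def)
  from univ[OF this] obtain k where k: "inj_on k {..n}" "k ` {..n} \<subseteq> pverts G"
    and karc: "\<And>u v. u \<le> n \<Longrightarrow> v \<le> n \<Longrightarrow> (u, v) \<in> parcs H \<longleftrightarrow> (k u, k v) \<in> parcs G"
    by (auto simp: embeds_induced_iff[OF wf] H_def)
  have arc1: "(k (h a), k (h b)) \<in> parcs G \<longleftrightarrow> (a, b) \<in> parcs G" if "a \<in> A" "b \<in> A" for a b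
    using that hn[OF that(1)] hn[OF that(2)] karc[of "h a" "h b"] by (auto simp: H_def h_eq)
  have arc2: "(k (h a), k n) \<in> parcs G \<longleftrightarrow> a \<in> I" if "a \<in> A" for a
    using that hn[OF that] karc[of "h a" n] by (auto simp: H_def h_eq dest: hn)
  have arc3: "(k n, k (h a)) \<in> parcs G \<longleftrightarrow> a \<in> J" if "a \<in> A" for a
    using that hn[OF that] karc[of n "h a"] by (auto simp: H_def h_eq dest: hn)
  define f where "f a = k (h a)" for a
  have injf: "inj_on f A"
  proof (rule inj_onI)
    fix a b assume ab: "a \<in> A" "b \<in> A" "f a = f b"
    then have "h a = h b"
      using inj_onD[OF k(1), of "h a" "h b"] hn[of a] hn[of b] by (simp add: f_def)
    then show "a = b" using h_eq ab by simp
  qed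
  have fV: "f ` A \<subseteq> pverts G"
    using k(2) hn by (auto simp: f_def image_subset_iff less_imp_le)
  let ?S = "\<lambda>W. \<lparr>pverts = W, parcs = parcs G \<inter> W \<times> W\<rparr>"
  let ?fi = "the_inv_into A f"
  have fi: "?fi (f a) = a" if "a \<in> A" for a
    using injf that by (simp add: the_inv_into_f_f)
  \<comment> \<open>\<open>f\<close> sends \<open>A\<close> to its copy inside the embedded
    \<open>H\<close>. Its inverse is a finite isomorphism, so it extends to an automorphism
    \<open>g\<close>, and \<open>g (k n)\<close> is the required vertex.\<close>
  have "digraph_isomorphism_map ?fi (?S (f ` A)) (?S A)"
    using bij_betw_the_inv_into[of f A "f ` A"] injf arc1
    by (auto simp: digraph_isomorphism_map_def bij_betw_def fi) (auto simp: f_def)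
  moreover have "induced_pair_subgraph (?S (f ` A)) G" "induced_pair_subgraph (?S A) G"
    using A fV wf by (auto simp: induced_pair_subgraph_iff)
  ultimately have "\<exists>g. digraph_isomorphism_map g G G \<and> (\<forall>a\<in>pverts (?S (f ` A)). g a = ?fi a)"
    using A(1) G(2)[unfolded ultrahomogeneous_def, rule_format, of "?S (f ` A)" "?S A" ?fi]
    by simp
  then obtain g where g: "digraph_isomorphism_map g G G" and gf: "\<And>a. a \<in> A \<Longrightarrow> g (f a) = a"
    by (auto simp: fi)
  have kn: "k n \<in> pverts G" using k(2) by auto
  have garc: "(g u, g v) \<in> parcs G \<longleftrightarrow> (u, v) \<in> parcs G" if "u \<in> pverts G" "v \<in> pverts G" for u v
    using g that by (auto simp: digraph_isomorphism_map_def)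
  \<comment> \<open>Otherwise injectivity of \<open>g\<close> would put \<open>k n\<close> into the
    copy of \<open>A\<close>, whose codes are all below \<open>n\<close>.\<close>
  have "g (k n) \<notin> A"
  proof
    assume a: "g (k n) \<in> A"
    then have "g (f (g (k n))) = g (k n)" by (rule gf)
    then have "f (g (k n)) = k n"
      using g a fV kn by (auto simp: digraph_isomorphism_map_def bij_betw_def inj_on_eq_iff)
    then have "h (g (k n)) = n"
      using k(1) hn[OF a] by (auto simp: f_def inj_on_eq_iff)
    with hn[OF a] show False by simp
  qed
  moreover have "g (k n) \<in> pverts G"
    using g kn by (auto simp: digraph_isomorphism_map_def bij_betw_def)
  moreover have "((a, g (k n)) \<in> parcs G \<longleftrightarrow> a \<in> I) \<and> ((g (k n), a) \<in> parcs G \<longleftrightarrow> a \<in> J)"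
    if "a \<in> A" for a
  proof -
    have "f a \<in> pverts G" using fV that by auto
    then show ?thesis
      using garc[of "f a" "k n"] garc[of "k n" "f a"] kn gf[OF that] arc2[OF that] arc3[OF that]
      by (simp add: f_def)
  qed
  ultimately show "\<exists>z\<in>pverts G - A. \<forall>a\<in>A.
      ((a, z) \<in> parcs G \<longleftrightarrow> a \<in> I) \<and> ((z, a) \<in> parcs G \<longleftrightarrow> a \<in> J)"
    by blast
qed

section \<open>Rank and countability of hereditarily finite sets\<close>

text \<open>The size of a set sums over its members, so \<open>size\<close> is a rank for
  membership; it excludes membership cycles below.\<close>

lemma size_elts:
  assumes "x |\<in>| S"
  shows "size x < size (HSet S)"
proof -
  have "size x \<le> (\<Sum>y\<in>fset S. size y)"
    using assms by (intro member_le_sum) auto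
  also have "\<dots> \<le> (\<Sum>y\<in>fset S. Suc (size y))" by (intro sum_mono) auto
  finally show ?thesis by simp
qed

text \<open>A set of size at most \<open>n\<close> has only members of size below \<open>n\<close>,
  so it is given by one of the finitely many subsets of the previous level.\<close>

lemma finite_hf_size_less: "finite {x :: hf. size x < n}"
proof (induction n)
  case (Suc n)
  have "{x. size x < Suc n} \<subseteq>
      insert Heart ((\<lambda>X. HSet (Abs_fset X)) ` Pow {x. size x < n})" (is "_ \<subseteq> ?R")
  proof
    fix x :: hf assume x: "x \<in> {x. size x < Suc n}"
    show "x \<in> ?R"
    proof (cases x)
      case (HSet S)
      have "fset S \<subseteq> {x. size x < n}"
        using x size_elts[of _ S] unfolding HSet by fastforce
      then show ?thesis unfolding HSet
        by (intro insertI2 image_eqI[of _ _ "fset S"]) (auto simp: fset_inverse)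
    qed simp
  qed
  then show ?case by (rule finite_subset) (use Suc in auto)
qed simp

lemma countable_hf: "countable (X :: hf set)"
proof -
  have "countable (\<Union>n. {x :: hf. size x < n})"
    by (intro countable_UN countableI_type countable_finite finite_hf_size_less)
  then show ?thesis by (rule countable_subset[rotated]) auto
qed

section \<open>The digraph \<open>R_in\<close>\<close>

lemma pverts_R_in: "pverts R_in = {HSet S | S. Heart |\<notin>| S}"
  by (simp add: R_in_def Let_def)

lemma parcs_R_in_HSet:
  "(HSet S, HSet T) \<in> parcs R_in \<longleftrightarrow>
     Heart |\<notin>| S \<and> Heart |\<notin>| T \<and> (HSet S |\<in>| T \<or> HSet (finsert Heart T) |\<in>| S)"
  by (auto simp: R_in_def Let_def left_part_def right_part_def)

text \<open>Such a set would be a member of itself. With \<open>x = Heart\<close> this rules out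
  loops arising from the right part.\<close>

lemma HSet_finsert_not_member: "HSet (finsert x S) |\<notin>| S"
proof
  assume "HSet (finsert x S) |\<in>| S"
  then have "HSet (finsert x S) |\<in>| finsert x S" by simp
  from size_elts[OF this] show False by simp
qed

lemma countable_digraph_R_in: "countable_digraph R_in"
proof -
  have "pair_loopfree_digraph R_in"
  proof
    fix e assume e: "e \<in> parcs R_in"
    then show "fst e \<in> pverts R_in" "snd e \<in> pverts R_in"
      by (auto simp: R_in_def Let_def)
    show "fst e \<noteq> snd e"
    proof
      assume "fst e = snd e"
      moreover obtain S where "fst e = HSet S"
        using \<open>fst e \<in> pverts R_in\<close> by (auto simp: pverts_R_in)
      ultimately have "(HSet S, HSet S) \<in> parcs R_in" using e by (metis prod.collapse)
      then show False
        using HSet_finsert_not_member[of Heart S] size_elts[of "HSet S" S]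
        by (auto simp: parcs_R_in_HSet)
    qed
  qed
  then show ?thesis by (simp add: countable_digraph_def countable_hf)
qed

lemma extension_property_R_in: "extension_property R_in"
  unfolding extension_property_def
proof (intro allI impI, elim conjE)
  fix A I J assume A: "finite A" "A \<subseteq> pverts R_in"
  define F where "F = Abs_fset A"
  have F: "fset F = A" using A(1) by (simp add: F_def Abs_fset_inverse)
  define Z where "Z = Abs_fset ((A \<inter> I) \<union> {HSet (finsert Heart S) | S. HSet S \<in> A \<inter> J} \<union> {HSet F})"
  \<comment> \<open>For finiteness only: the missing \<open>Heart\<close> case is harmless, since an
    inclusion in the image suffices.\<close>
  have "{HSet (finsert Heart S) | S. HSet S \<in> A \<inter> J}
      \<subseteq> (\<lambda>x. case x of HSet S \<Rightarrow> HSet (finsert Heart S)) ` A"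
    by (force intro: rev_image_eqI)
  then have "finite {HSet (finsert Heart S) | S. HSet S \<in> A \<inter> J}"
    using A(1) finite_subset by blast
  then have Z: "fset Z = (A \<inter> I) \<union> {HSet (finsert Heart S) | S. HSet S \<in> A \<inter> J} \<union> {HSet F}"
    using A(1) by (simp add: Z_def Abs_fset_inverse)
  have noHeart: "\<exists>S. a = HSet S \<and> Heart |\<notin>| S" if "a \<in> A" for a
    using A(2) that by (auto simp: pverts_R_in)
  have HZ: "Heart |\<notin>| Z" using Z noHeart by auto
  have HF: "Heart |\<notin>| F" using F noHeart by auto
  have sizeA: "size a < size (HSet F)" if "a \<in> A" for a
    using that F by (intro size_elts) auto
  have sizeF: "size (HSet F) < size (HSet Z)"
    using Z by (intro size_elts) auto
  \<comment> \<open>The sizes increase strictly from the vertices of \<open>A\<close> to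
    \<open>HSet F\<close> and on to \<open>HSet Z\<close>.\<close>
  have "HSet Z \<notin> A" using sizeA sizeF by (meson less_asym)
  moreover have "HSet Z \<in> pverts R_in" using HZ by (auto simp: pverts_R_in)
  moreover have "((a, HSet Z) \<in> parcs R_in \<longleftrightarrow> a \<in> I) \<and> ((HSet Z, a) \<in> parcs R_in \<longleftrightarrow> a \<in> J)"
    if a: "a \<in> A" for a
  proof -
    obtain S where S: "a = HSet S" "Heart |\<notin>| S" using noHeart[OF a] by blast
    \<comment> \<open>\<open>Z\<close>, with or without the heart, contains \<open>HSet F\<close>
      and so is too large to be a member of \<open>a\<close>. Hence membership in \<open>Z\<close>
      alone decides both arcs.\<close>
    have "HSet Z |\<notin>| S"
      using size_elts[of "HSet Z" S] sizeA[OF a] sizeF unfolding S(1)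
      by (meson less_asym less_trans)
    moreover have "HSet (finsert Heart Z) |\<notin>| S"
    proof
      assume "HSet (finsert Heart Z) |\<in>| S"
      then have "size (HSet (finsert Heart Z)) < size (HSet F)"
        using less_trans[OF size_elts sizeA[OF a, unfolded S(1)]] by blast
      moreover have "HSet F |\<in>| finsert Heart Z" using Z by auto
      ultimately show False
        using size_elts[of "HSet F" "finsert Heart Z"] by (meson less_asym)
    qed
    \<comment> \<open>The three groups of members of \<open>Z\<close> do not interfere: those from
      \<open>I\<close> lack the heart, those from \<open>J\<close> contain it, and
      \<open>HSet F\<close> is larger than the former and, unlike the latter, heart-free.\<close>
    moreover have "HSet S |\<in>| Z \<longleftrightarrow> a \<in> I"
    proof -
      have "HSet S \<noteq> HSet F" using sizeA[OF a] S(1) by auto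
      then show ?thesis using Z a S by auto
    qed
    moreover have "HSet (finsert Heart S) |\<in>| Z \<longleftrightarrow> a \<in> J"
    proof -
      have "HSet (finsert Heart S) \<noteq> HSet F" using HF by auto
      moreover have "HSet (finsert Heart S) \<notin> A" using noHeart by fastforce
      \<comment> \<open>Adding the heart is injective on heart-free sets, so the member coding
        \<open>a\<close> codes no other vertex.\<close>
      moreover have "S' = S" if "finsert Heart S = finsert Heart S'" "HSet S' \<in> A" for S'
        using that S(2) noHeart[of "HSet S'"] by (metis finsert_ident hf.inject)
      ultimately show ?thesis using Z a S by auto
    qed
    ultimately show ?thesis using HZ S by (simp add: parcs_R_in_HSet)
  qed
  ultimately show "\<exists>z\<in>pverts R_in - A. \<forall>a\<in>A.
      ((a, z) \<in> parcs R_in \<longleftrightarrow> a \<in> I) \<and> ((z, a) \<in> parcs R_in \<longleftrightarrow> a \<in> J)"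
    by blast
qed

text \<open>The second conjunct frees universality from the vertex type \<open>nat\<close> fixed in
  \<open>generic_digraph\<close>; the third justifies speaking of the generic digraph.\<close>

theorem theorem2p6:
  fixes H :: "'b pair_pre_digraph" and G :: "'c pair_pre_digraph"
  shows "generic_digraph R_in \<and>
    (countable_digraph H \<longrightarrow> embeds_induced H R_in) \<and>
    (generic_digraph G \<longrightarrow> isomorphic_digraphs R_in G)"
proof (intro conjI impI)
  note R = countable_digraph_R_in extension_property_R_in
  show "generic_digraph R_in"
    unfolding generic_digraph_def
    using R extension_property_ultrahomogeneous[OF R] extension_property_universal[OF R] by blast
  show "embeds_induced H R_in" if "countable_digraph H"
    using extension_property_universal[OF R that] .
  show "isomorphic_digraphs R_in G" if "generic_digraph G"
  proof (rule extension_property_isomorphic[OF R _ generic_imp_extension_property[OF that]])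
    show "countable_digraph G" using that by (simp add: generic_digraph_def)
  qed
qed

end
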